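(* Let $n>11$ be an integer and write $n=7k+r$ with integers $k\ge 0$ and $0\le r\le 6$. Then \[\gamma^{SID}(C_n(1,3))=\begin{cases}4k & r=0,\\ 4k+1 & r=1,\\ 4k+2 & r=2,\\ 4k+3 & r\in\{3,4\},\\ 4k+4 & r\in\{5,6\}.\end{cases}\]
   Context: All graphs are simple and undirected. For a graph $G=(V,E)$ and $u\in V$, $N[u]=\{u\}\cup\{v: uv\in E\}$. A code is a nonempty $C\subseteq V$, and $I(C;u)=N[u]\cap C$. $C$ is self-identifying if $I(C;u)\setminus I(C;v)\neq\emptyset$ for all distinct $u,v\in V$. $\gamma^{SID}(G)$ is the minimum cardinality of a self-identifying code in a finite graph $G$. The circulant graph $C_n(1,3)$ has vertex set $\mathbb{Z}_n$, and the open neighbourhood of $u$ is $\{u\pm1,u\pm3\}$ modulo $n$. *)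

theory Defs
  imports "Graph_Theory.Pair_Digraph" "HOL-Number_Theory.Cong"
begin

text \<open>A finite simple undirected graph is a \<^locale>\<open>pair_graph\<close>: every edge \<open>uv\<close> is
  represented by the two arcs \<open>(u, v)\<close> and \<open>(v, u)\<close>.\<close>

definition closed_nbhd :: "'a pair_pre_digraph \<Rightarrow> 'a \<Rightarrow> 'a set" where
  "closed_nbhd G u = {u} \<union> {v. (u, v) \<in> parcs G}"

definition is_code :: "'a pair_pre_digraph \<Rightarrow> 'a set \<Rightarrow> bool" where
  "is_code G C \<longleftrightarrow> C \<noteq> {} \<and> C \<subseteq> pverts G"

definition I_set :: "'a pair_pre_digraph \<Rightarrow> 'a set \<Rightarrow> 'a \<Rightarrow> 'a set" where
  "I_set G C u = closed_nbhd G u \<inter> C"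

definition self_identifying :: "'a pair_pre_digraph \<Rightarrow> 'a set \<Rightarrow> bool" where
  "self_identifying G C \<longleftrightarrow> is_code G C \<and>
     (\<forall>u\<in>pverts G. \<forall>v\<in>pverts G. u \<noteq> v \<longrightarrow> I_set G C u - I_set G C v \<noteq> {})"

text \<open>Meaningful only for graphs that admit a self-identifying code; see
  \<open>gamma_SID_attained\<close> and \<open>gamma_SID_le\<close>, and \<open>self_identifying_circulant\<close> for \<open>C\<^sub>n(1,3)\<close>.\<close>

definition gamma_SID :: "'a pair_pre_digraph \<Rightarrow> nat" where
  "gamma_SID G = (LEAST m. \<exists>C. self_identifying G C \<and> card C = m)"

lemma gamma_SID_attained:
  assumes "self_identifying G D"
  shows "\<exists>C. self_identifying G C \<and> card C = gamma_SID G"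
  unfolding gamma_SID_def by (rule LeastI_ex) (use assms in blast)

lemma gamma_SID_le:
  assumes "self_identifying G C"
  shows "gamma_SID G \<le> card C"
  unfolding gamma_SID_def by (rule Least_le) (use assms in blast)

text \<open>\<open>\<int>\<^sub>n\<close> is represented by the residues \<open>0, \<dots>, n - 1\<close>.\<close>

definition circulant :: "nat \<Rightarrow> int set \<Rightarrow> int pair_pre_digraph" where
  "circulant n S =
     \<lparr> pverts = {0..<int n},
       parcs = {(u, v). u \<in> {0..<int n} \<and> v \<in> {0..<int n} \<and>
                  (\<exists>s\<in>S. [v = u + s] (mod int n) \<or> [v = u - s] (mod int n))} \<rparr>"

lemma pair_graph_circulant:
  assumes "n > 3"
  shows "pair_graph (circulant n {1, 3})"
proof -
  have no_dvd: "\<not> int n dvd 1" "\<not> int n dvd 3"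
    using assms by (auto dest: zdvd_imp_le)
  have sym: "[u = v + s] (mod int n) \<longleftrightarrow> [v = u - s] (mod int n)" for u v s
    by (metis cong_add_rcancel cong_sym_eq diff_add_cancel)
  have fin: "finite (parcs (circulant n {1, 3}))"
    by (rule finite_subset[of _ "{0..<int n} \<times> {0..<int n}"]) (auto simp: circulant_def)
  have nl: "u \<noteq> v" if "(u, v) \<in> parcs (circulant n {1, 3})" for u v
    using that no_dvd by (auto simp: circulant_def cong_iff_dvd_diff)
  have wf: "u \<in> pverts (circulant n {1, 3}) \<and> v \<in> pverts (circulant n {1, 3})"
    if "(u, v) \<in> parcs (circulant n {1, 3})" for u v
    using that by (simp add: circulant_def)
  have finv: "finite (pverts (circulant n {1, 3}))"
    by (simp add: circulant_def)
  have symm: "symmetric (with_proj (circulant n {1, 3}))"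
    unfolding symmetric_def by (rule symI) (auto simp: circulant_def sym)
  show ?thesis
    by unfold_locales (use wf finv fin symm nl in \<open>force+\<close>)
qed

lemma self_identifying_circulant:
  assumes "n > 11"
  shows "self_identifying (circulant n {1, 3}) (pverts (circulant n {1, 3}))"
proof -
  let ?G = "circulant n {1, 3}" and ?O = "{0, 1, -1, 3, -3 :: int}"
  have zero: "x = 0" if "int n dvd x" "\<bar>x\<bar> < 12" for x
    using that assms dvd_imp_le_int[of x "int n"] by auto
  have bnd: "\<bar>x\<bar> \<le> 3" if "x \<in> ?O" for x
    using that by auto
  have mem: "w \<in> closed_nbhd ?G u \<longleftrightarrow> w \<in> {0..<int n} \<and> (\<exists>a\<in>?O. int n dvd w - u - a)"
    if "u \<in> {0..<int n}" for u w
  proof -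
    have "w = u" if "int n dvd w - u" "w \<in> {0..<int n}"
      using that \<open>u \<in> {0..<int n}\<close> by (metis atLeastLessThan_iff cong_iff_dvd_diff cong_less_imp_eq_int)
    then show ?thesis
      using that by (auto simp: closed_nbhd_def circulant_def cong_iff_dvd_diff algebra_simps)
  qed
  have "\<not> closed_nbhd ?G u \<subseteq> closed_nbhd ?G v"
    if uv: "u \<in> {0..<int n}" "v \<in> {0..<int n}" "u \<noteq> v" for u v
  proof
    assume sub: "closed_nbhd ?G u \<subseteq> closed_nbhd ?G v"
    have shift: "\<exists>b\<in>?O. int n dvd u - v + a - b" if "a \<in> ?O" for a
    proof -
      have red: "int n dvd (u + a) mod int n - (u + a)"
        by (metis cong_iff_dvd_diff cong_mod_left cong_refl)
      then have "(u + a) mod int n \<in> closed_nbhd ?G u"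
        using that assms by (subst mem[OF uv(1)]) (auto simp: algebra_simps intro!: bexI[of _ a])
      with sub obtain b where "b \<in> ?O" "int n dvd (u + a) mod int n - v - b"
        using mem[OF uv(2)] by blast
      with dvd_diff[OF this(2) red] show ?thesis
        by (intro bexI[of _ b]) (auto simp: algebra_simps)
    qed
    obtain d where d: "d \<in> ?O" "int n dvd u - v - d"
      using shift[of 0] by (metis add_0_right insertI1)
    have d0: "d \<noteq> 0"
      using d(2) uv by (metis atLeastLessThan_iff cong_iff_dvd_diff cong_less_imp_eq_int diff_zero)
    have "\<exists>b\<in>?O. d + a = b" if a: "a \<in> ?O" for a
    proof -
      obtain b where b: "b \<in> ?O" "int n dvd u - v + a - b"
        using shift[OF a] by blast
      have "int n dvd d + a - b"
        using dvd_diff[OF b(2) d(2)] by (simp add: algebra_simps)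
      moreover have "\<bar>d + a - b\<bar> < 12"
        using bnd[OF d(1)] bnd[OF a] bnd[OF b(1)] by linarith
      ultimately have "d + a - b = 0"
        by (rule zero)
      then show ?thesis
        using b(1) by (intro bexI[of _ b]) simp_all
    qed
    then have "\<forall>a\<in>?O. \<exists>b\<in>?O. d + a = b"
      by blast
    then show False
      using d(1) d0 by (elim insertE emptyE) simp_all
  qed
  moreover have "closed_nbhd ?G u \<subseteq> pverts ?G" if "u \<in> pverts ?G" for u
    using that by (auto simp: closed_nbhd_def circulant_def)
  moreover have "pverts ?G = {0..<int n}"
    by (simp add: circulant_def)
  ultimately show ?thesis
    using assms unfolding self_identifying_def is_code_def I_set_def
    by (simp add: Int_absorb2 Diff_eq_empty_iff)
qed

end

theory Submission
  imports Defs
begin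

text \<open>
  Call the vertices outside a code zeros and the others ones. For \<open>n > 12\<close> a set is a self-identifying
  code of \<open>C\<^sub>n(1,3)\<close> iff there are no zeros of the form \<open>{x, x+3}\<close>, \<open>{x, x+2, x+4}\<close>,
  \<open>{x, x+2, x+6}\<close> or \<open>{x, x+4, x+6}\<close>. Let every one contribute \<open>3\<close> and every zero \<open>-4\<close>; the total
  over \<open>\<int>\<^sub>n\<close> is \<open>7|C| - 4n\<close>. Pour these amounts into a bucket of capacity \<open>12\<close>: sparsity of the zeros
  ensures that it never runs dry, so the total equals what overflows and is nonnegative.
  If less than \<open>3\<close> overflows, the zeros come in runs of length two or three. A run of length two
  forces another one five places later, and each costs \<open>1\<close>, so there is none, as \<open>n > 10\<close> leaves
  room for three. A run of length three forces another one seven places earlier, which is impossible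
  if \<open>7\<close> does not divide \<open>n\<close>. Hence \<open>7|C| - 4n\<close> is \<open>0\<close> or at least \<open>3\<close>, which is the lower bound in every residue class.
  It is attained by repeating \<open>0001111\<close> after a prefix: \<open>r\<close> ones for \<open>r \<le> 3\<close>, and
  \<open>00111001111\<close>, \<open>001111001111\<close>, \<open>001111\<close> for \<open>r = 4, 5, 6\<close>.
\<close>

section \<open>Separation as a condition on offsets modulo \<open>n\<close>, and sums over a
  period\<close>

lemma closed_nbhd_circulant:
  assumes "u \<in> {0..<int n}"
  shows "w \<in> closed_nbhd (circulant n {1, 3}) u \<longleftrightarrow>
    w \<in> {0..<int n} \<and> (\<exists>a\<in>{0, 1, -1, 3, -3}. int n dvd w - u - a)"
proof -
  have "w = u" if "int n dvd w - u" "w \<in> {0..<int n}"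
    using that assms by (metis atLeastLessThan_iff cong_iff_dvd_diff cong_less_imp_eq_int)
  then show ?thesis
    using assms by (auto simp: closed_nbhd_def circulant_def cong_iff_dvd_diff algebra_simps)
qed

lemma dvd_mod_diff_iff:
  fixes m x y :: int
  shows "m dvd x mod m - y \<longleftrightarrow> m dvd x - y"
  by (metis mod_diff_left_eq mod_eq_0_iff_dvd)

text \<open>Writing the second vertex as \<open>u + d\<close> and the members of a closed
  neighbourhood as \<open>u\<close> plus an offset reduces separation to arithmetic of offsets.
  Letting \<open>u\<close> and \<open>d\<close> range over all integers makes the condition
  invariant under translation.\<close>

lemma self_identifying_circulant_iff:
  assumes "n > 11"
  shows "self_identifying (circulant n {1, 3}) C \<longleftrightarrow>
    C \<noteq> {} \<and> C \<subseteq> {0..<int n} \<and>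
    (\<forall>u d. \<not> int n dvd d \<longrightarrow>
      (\<exists>a\<in>{0, 1, -1, 3, -3}. (u + a) mod int n \<in> C \<and>
        (\<forall>b\<in>{0, 1, -1, 3, -3}. \<not> int n dvd a - b - d)))"
    (is "?S \<longleftrightarrow> ?N \<and> ?C \<and> ?A")
proof -
  let ?G = "circulant n {1, 3}" and ?O = "{0, 1, -1, 3, -3 :: int}"
  have V: "pverts ?G = {0..<int n}"
    by (simp add: circulant_def)
  have pos: "int n > 0"
    using assms by simp
  have sep: "I_set ?G C (u mod int n) - I_set ?G C ((u + d) mod int n) \<noteq> {} \<longleftrightarrow>
      (\<exists>a\<in>?O. (u + a) mod int n \<in> C \<and> (\<forall>b\<in>?O. \<not> int n dvd a - b - d))" for u d
  proof -
    have m: "w \<in> closed_nbhd ?G (x mod int n) \<longleftrightarrow>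
        w \<in> {0..<int n} \<and> (\<exists>a\<in>?O. int n dvd w - x - a)" for w x
    proof -
      have "int n dvd w - x mod int n - a \<longleftrightarrow> int n dvd w - x - a" for a
      proof -
        have "int n dvd w - x mod int n - a \<longleftrightarrow> int n dvd x mod int n - (w - a)"
          by (subst dvd_minus_iff[symmetric]) (simp add: algebra_simps)
        also have "\<dots> \<longleftrightarrow> int n dvd w - x - a"
          unfolding dvd_mod_diff_iff
          by (subst dvd_minus_iff[symmetric]) (simp add: algebra_simps)
        finally show ?thesis .
      qed
      then show ?thesis
        using pos by (subst closed_nbhd_circulant) auto
    qed
    show ?thesis
    proof
      assume "I_set ?G C (u mod int n) - I_set ?G C ((u + d) mod int n) \<noteq> {}"
      then obtain w where w: "w \<in> C" "w \<in> closed_nbhd ?G (u mod int n)"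
        "w \<notin> closed_nbhd ?G ((u + d) mod int n)"
        by (auto simp: I_set_def)
      then obtain a where a: "a \<in> ?O" "int n dvd w - u - a" and wr: "w \<in> {0..<int n}"
        by (auto simp only: m)
      have "w = (u + a) mod int n"
        using a(2) wr by (metis atLeastLessThan_iff diff_diff_add mod_eq_dvd_iff mod_pos_pos_trivial)
      moreover have "\<not> int n dvd a - b - d" if "b \<in> ?O" for b
      proof
        assume "int n dvd a - b - d"
        from dvd_add[OF a(2) this] have "int n dvd w - (u + d) - b"
          by (simp add: algebra_simps)
        then show False
          using w(3) wr that by (auto simp only: m)
      qed
      ultimately show "\<exists>a\<in>?O. (u + a) mod int n \<in> C \<and> (\<forall>b\<in>?O. \<not> int n dvd a - b - d)"
        using a(1) w(1) by blast
    next
      assume "\<exists>a\<in>?O. (u + a) mod int n \<in> C \<and> (\<forall>b\<in>?O. \<not> int n dvd a - b - d)"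
      then obtain a where a: "a \<in> ?O" "(u + a) mod int n \<in> C"
        "\<And>b. b \<in> ?O \<Longrightarrow> \<not> int n dvd a - b - d"
        by blast
      have dv: "int n dvd (u + a) mod int n - x - b \<longleftrightarrow> int n dvd u + a - x - b" for x b
        using dvd_mod_diff_iff[of "int n" "u + a" "x + b"] by (simp add: algebra_simps)
      have "(u + a) mod int n \<in> closed_nbhd ?G (u mod int n)"
        unfolding m dv using a(1) pos by (auto intro!: bexI[of _ a])
      moreover have "(u + a) mod int n \<notin> closed_nbhd ?G ((u + d) mod int n)"
        unfolding m dv using a(3) by (auto simp: algebra_simps)
      ultimately show "I_set ?G C (u mod int n) - I_set ?G C ((u + d) mod int n) \<noteq> {}"
        using a(2) by (auto simp: I_set_def)
    qed
  qed
  have "(\<forall>u\<in>{0..<int n}. \<forall>v\<in>{0..<int n}. u \<noteq> v \<longrightarrow> I_set ?G C u - I_set ?G C v \<noteq> {})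
    \<longleftrightarrow> (\<forall>u d. \<not> int n dvd d \<longrightarrow>
      I_set ?G C (u mod int n) - I_set ?G C ((u + d) mod int n) \<noteq> {})" (is "?L \<longleftrightarrow> ?R")
  proof
    assume L: ?L
    show ?R
    proof (intro allI impI)
      fix u d assume "\<not> int n dvd d"
      then have "u mod int n \<noteq> (u + d) mod int n"
        by (metis add_diff_cancel_left' mod_eq_dvd_iff)
      then show "I_set ?G C (u mod int n) - I_set ?G C ((u + d) mod int n) \<noteq> {}"
        using L pos by simp
    qed
  next
    assume R: ?R
    show ?L
    proof (intro ballI impI)
      fix u v assume uv: "u \<in> {0..<int n}" "v \<in> {0..<int n}" "u \<noteq> v"
      then have "\<not> int n dvd v - u"
        by (metis atLeastLessThan_iff mod_eq_dvd_iff mod_pos_pos_trivial)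
      then show "I_set ?G C u - I_set ?G C v \<noteq> {}"
        using R[rule_format, of "v - u" u] uv by simp
    qed
  qed
  then show ?thesis
    unfolding self_identifying_def is_code_def V sep by blast
qed

lemma sum_periodic_window:
  fixes g :: "int \<Rightarrow> 'a::comm_monoid_add"
  assumes per: "\<And>x. g (x + N) = g x" and "N \<ge> 0"
  shows "sum g {a..<a + N} = sum g {0..<N}"
proof -
  have step: "sum g {b + 1..<b + 1 + N} = sum g {b..<b + N}" for b
  proof (cases "N = 0")
    case False
    then have "{b..<b + N} = insert b {b + 1..<b + N}"
      and "{b + 1..<b + 1 + N} = insert (b + N) {b + 1..<b + N}"
      using \<open>N \<ge> 0\<close> by auto
    then show ?thesis
      by (simp add: per)
  qed simp
  show ?thesis
  proof (induction a rule: int_induct[of _ 0])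
    case (step1 i)
    then show ?case using step[of i] by simp
  next
    case (step2 i)
    then show ?case using step[of "i - 1"] by simp
  qed simp
qed

section \<open>Codes and forbidden patterns of zeros\<close>

text \<open>The predicate lives on all integers: a cyclic word becomes a periodic predicate, and the
  same conditions can be imposed on a finite piece of a word.\<close>

locale sparse_zeros =
  fixes z :: "int \<Rightarrow> bool"
  assumes z3: "z x \<Longrightarrow> \<not> z (x + 3)"
    and z24: "z x \<Longrightarrow> z (x + 2) \<Longrightarrow> \<not> z (x + 4)"
    and z26: "z x \<Longrightarrow> z (x + 2) \<Longrightarrow> \<not> z (x + 6)"
    and z46: "z x \<Longrightarrow> z (x + 4) \<Longrightarrow> \<not> z (x + 6)"

text \<open>Removing the neighbours of \<open>u + d\<close> from those of \<open>u\<close> leaves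
  the offsets 0, -3 for \<open>d = 2\<close>; -3, -1, 1 for \<open>d = 3\<close>; -3, -1, 3 for
  \<open>d = 1\<close>; and -3, 1, 3 for \<open>d = -1\<close>. The code meets each of these sets,
  and \<open>u = x + 3\<close> turns them into the four patterns.\<close>

lemma self_identifying_imp_sparse_zeros:
  assumes n: "n > 11" and C: "self_identifying (circulant n {1, 3}) C"
  shows "sparse_zeros (\<lambda>x. x mod int n \<notin> C)"
proof -
  have small: "\<not> int n dvd x" if "x \<noteq> 0" "\<bar>x\<bar> < 12" for x
    using that n dvd_imp_le_int[of x "int n"] by auto
  have sep: "\<exists>a\<in>{0, 1, -1, 3, -3}. (u + a) mod int n \<in> C \<and>
        (\<forall>b\<in>{0, 1, -1, 3, -3}. a - b \<noteq> d)" if d: "d \<noteq> 0" "\<bar>d\<bar> < 12" for u d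
  proof -
    obtain a where a: "a \<in> {0, 1, -1, 3, -3}" "(u + a) mod int n \<in> C"
      "\<And>b. b \<in> {0, 1, -1, 3, -3} \<Longrightarrow> \<not> int n dvd a - b - d"
      using C[unfolded self_identifying_circulant_iff[OF n], THEN conjunct2, THEN conjunct2,
          rule_format, OF small[OF d], of u] by (elim bexE conjE) (rule that, assumption+, rule bspec)
    then have "\<forall>b\<in>{0, 1, -1, 3, -3}. a - b \<noteq> d"
      by (metis diff_self dvd_0_right)
    with a show ?thesis by blast
  qed
  show ?thesis
  proof
    fix x
    show "\<not> (x + 3) mod int n \<notin> C" if "x mod int n \<notin> C"
      using sep[of 2 "x + 3"] that by (auto simp: add.commute)
    show "\<not> (x + 4) mod int n \<notin> C" if "x mod int n \<notin> C" "(x + 2) mod int n \<notin> C"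
      using sep[of 3 "x + 3"] that by (auto simp: add.commute)
    show "\<not> (x + 6) mod int n \<notin> C" if "x mod int n \<notin> C" "(x + 2) mod int n \<notin> C"
      using sep[of 1 "x + 3"] that by (auto simp: add.commute)
    show "\<not> (x + 6) mod int n \<notin> C" if "x mod int n \<notin> C" "(x + 4) mod int n \<notin> C"
      using sep[of "-1" "x + 3"] that by (auto simp: add.commute)
  qed
qed

text \<open>For \<open>n = 12\<close> the vertices \<open>u + 6\<close> and \<open>u - 6\<close> coincide, which yields the extra condition.\<close>

lemma sparse_zeros_imp_self_identifying:
  assumes n: "n > 11" and C: "C \<subseteq> {0..<int n}"
    and sp: "sparse_zeros (\<lambda>x. x mod int n \<notin> C)"
    and n12: "\<And>x. n = 12 \<Longrightarrow> x mod int n \<in> C \<or> (x + 1) mod int n \<in> C \<or> (x + 2) mod int n \<in> C"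
  shows "self_identifying (circulant n {1, 3}) C"
proof -
  let ?O = "{0, 1, -1, 3, -3 :: int}"
  interpret sparse_zeros "\<lambda>x. x mod int n \<notin> C" by fact
  have zero: "x = 0" if "int n dvd x" "\<bar>x\<bar> < int n" for x
    using that dvd_imp_le_int[of x "int n"] by auto
  have "\<exists>a\<in>?O. (u + a) mod int n \<in> C \<and> (\<forall>b\<in>?O. \<not> int n dvd a - b - d)"
    if d: "\<not> int n dvd d" for u d
  \<comment> \<open>The listed values are the nonzero differences of two offsets. For every other
    \<open>d\<close> the two closed neighbourhoods are disjoint, and any code vertex near
    \<open>u\<close> separates.\<close>
  proof (cases "\<exists>e\<in>{1,-1,2,-2,3,-3,4,-4,6,-6}. int n dvd d - e")
    case True
    then obtain e where e: "e \<in> {1,-1,2,-2,3,-3,4,-4,6,-6}" "int n dvd d - e" by blast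
    have eq: "int n dvd a - b - d \<longleftrightarrow> int n dvd a - b - e" for a b
      using dvd_add_right_iff[OF e(2), of "a - b - d"] by (simp add: algebra_simps)
    have f: "u mod int n \<in> C \<or> (u + 3) mod int n \<in> C" "u mod int n \<in> C \<or> (u - 3) mod int n \<in> C"
      "(u - 3) mod int n \<in> C \<or> (u - 1) mod int n \<in> C \<or> (u + 1) mod int n \<in> C"
      "(u - 1) mod int n \<in> C \<or> (u + 1) mod int n \<in> C \<or> (u + 3) mod int n \<in> C"
      "(u - 3) mod int n \<in> C \<or> (u - 1) mod int n \<in> C \<or> (u + 3) mod int n \<in> C"
      "(u - 3) mod int n \<in> C \<or> (u + 1) mod int n \<in> C \<or> (u + 3) mod int n \<in> C"
      "n = 12 \<Longrightarrow> (u - 1) mod int n \<in> C \<or> u mod int n \<in> C \<or> (u + 1) mod int n \<in> C"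
      using z3[of u] z3[of "u - 3"] z24[of "u - 3"] z24[of "u - 1"] z26[of "u - 3"] z46[of "u - 3"]
        n12[of "u - 1"] by (auto simp: add.commute)
    \<comment> \<open>The numbers \<open>a - b - e\<close> have absolute value at most 12, so
      divisibility by \<open>n\<close> means being 0, except that 12 and -12 also count when
      \<open>n = 12\<close>.\<close>
    have "\<exists>a\<in>?O. (u + a) mod int n \<in> C \<and>
        (\<forall>b\<in>?O. a - b \<noteq> e \<and> (n = 12 \<longrightarrow> a - b - e \<noteq> 12 \<and> a - b - e \<noteq> - 12))"
      using e(1)
    proof (elim insertE emptyE, goal_cases)
      case 1 then show ?case using f(5) by auto
    next
      case 2 then show ?case using f(6) by auto
    next
      case 3 then show ?case using f(2) by auto
    next
      case 4 then show ?case using f(1) by auto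
    next
      case 5 then show ?case using f(3) by auto
    next
      case 6 then show ?case using f(4) by auto
    next
      case 7 then show ?case using f(2) by auto
    next
      case 8 then show ?case using f(1) by auto
    next
      \<comment> \<open>For \<open>e = 6\<close> only the offset 3 is lost, but modulo 12 the offset
        -3 is lost as well. What remains is -1, 0, 1, hence the condition on three consecutive
        vertices.\<close>
      case 9 then show ?case using f(2,7) by (cases "n = 12") auto
    next
      case 10 then show ?case using f(1,7) by (cases "n = 12") auto
    qed
    then obtain a where a: "a \<in> ?O" "(u + a) mod int n \<in> C"
      "\<And>b. b \<in> ?O \<Longrightarrow> a - b \<noteq> e \<and> (n = 12 \<longrightarrow> a - b - e \<noteq> 12 \<and> a - b - e \<noteq> - 12)"
      by blast
    have "\<not> int n dvd a - b - d" if b: "b \<in> ?O" for b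
    proof
      assume "int n dvd a - b - d"
      then have "int n dvd a - b - e" by (simp only: eq)
      moreover have "\<bar>a - b - e\<bar> \<le> 12"
      proof -
        have "\<bar>a\<bar> \<le> 3" "\<bar>b\<bar> \<le> 3" "\<bar>e\<bar> \<le> 6"
          using a(1) b e(1) by auto
        then show ?thesis by linarith
      qed
      ultimately show False
        using zero[of "a - b - e"] a(3)[OF b] n by linarith
    qed
    with a(1,2) show ?thesis by blast
  next
    case False
    then have no: "\<not> int n dvd a - b - d" if "a \<in> ?O" "b \<in> ?O" for a b
    proof -
      have "a - b \<in> {0,1,-1,2,-2,3,-3,4,-4,6,-6}"
        using that by auto
      then have "\<not> int n dvd d - (a - b)"
        using False d by auto
      then show ?thesis
        by (metis dvd_minus_iff minus_diff_eq)
    qed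
    have "u mod int n \<in> C \<or> (u + 3) mod int n \<in> C"
      using z3[of u] by auto
    then show ?thesis
      using no by auto
  qed
  moreover have "C \<noteq> {}"
    using z3[of 0] by auto
  ultimately show ?thesis
    using C by (simp add: self_identifying_circulant_iff[OF n])
qed

section \<open>The bucket: levels and overflow\<close>

context sparse_zeros
begin

text \<open>The content of the bucket just before position \<open>u\<close>, as a function of the six preceding positions.
  A zero two places after a zero lowers it as if the two were adjacent, at the cost of an overflow
  of \<open>3\<close>.\<close>

definition level :: "int \<Rightarrow> int" where
  "level u =
    (if z (u - 1) then 8 - 4 * of_bool (z (u - 2)) - 4 * of_bool (z (u - 3))
     else if z (u - 2) then 11 - 4 * of_bool (z (u - 3)) - 4 * of_bool (z (u - 4))
     else if z (u - 3) then min 12 (14 - 4 * of_bool (z (u - 4)) - 4 * of_bool (z (u - 5)))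
     else if z (u - 4) then min 12 (17 - 4 * of_bool (z (u - 5)) - 4 * of_bool (z (u - 6)))
     else 12)"

text \<open>The inflow is 3 at a one and \<open>3 - 7\<close>, that is -4, at a zero. What the
  change of level does not absorb is spilled.\<close>

definition overflow :: "int \<Rightarrow> int" where
  "overflow u = level u + 3 - 7 * of_bool (z u) - level (u + 1)"

text \<open>Expands the later level only, with arguments of the form \<open>u - i\<close>, so that
  both levels refer to the same positions in a case split.\<close>

lemma overflow_unfold:
  "overflow u = level u + 3 - 7 * of_bool (z u) -
    (if z u then 8 - 4 * of_bool (z (u - 1)) - 4 * of_bool (z (u - 2))
     else if z (u - 1) then 11 - 4 * of_bool (z (u - 2)) - 4 * of_bool (z (u - 3))
     else if z (u - 2) then min 12 (14 - 4 * of_bool (z (u - 3)) - 4 * of_bool (z (u - 4)))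
     else if z (u - 3) then min 12 (17 - 4 * of_bool (z (u - 4)) - 4 * of_bool (z (u - 5)))
     else 12)"
  by (simp add: overflow_def level_def algebra_simps)

text \<open>A finite check: the spill depends on the positions \<open>u - 6\<close> to
  \<open>u\<close> only, and the instances supplied are all forbidden patterns that fit in this
  window.\<close>

lemma overflow_nonneg: "overflow u \<ge> 0"
  using z3[of "u - 3"] z3[of "u - 4"] z3[of "u - 5"] z3[of "u - 6"]
    z24[of "u - 4"] z24[of "u - 5"] z24[of "u - 6"] z26[of "u - 6"] z46[of "u - 6"]
  unfolding overflow_unfold level_def
  by (cases "z u"; cases "z (u - 1)"; cases "z (u - 2)"; cases "z (u - 3)";
      cases "z (u - 4)"; cases "z (u - 5)"; cases "z (u - 6)") simp_all

lemma overflow_five_ones: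
  "\<not> z u \<Longrightarrow> \<not> z (u - 1) \<Longrightarrow> \<not> z (u - 2) \<Longrightarrow> \<not> z (u - 3) \<Longrightarrow> \<not> z (u - 4) \<Longrightarrow> overflow u = 3"
  by (simp add: overflow_unfold level_def)

lemma overflow_zero_one_zero:
  assumes "z u" "\<not> z (u + 1)" "z (u + 2)"
  shows "overflow (u + 2) = 3"
  using assms z3[of "u - 1"] z24[of "u - 2"]
  by (auto simp: overflow_unfold level_def add.commute)

text \<open>A lone zero leaves level 8. The next two ones would raise it to 14, so the bucket is
  full and the third one spills entirely.\<close>

lemma overflow_isolated:
  assumes "z u" "\<not> z (u - 2)" "\<not> z (u - 1)" "\<not> z (u + 1)" "\<not> z (u + 2)"
  shows "overflow (u + 3) = 3"
  using assms z3[of u] by (auto simp: overflow_unfold level_def add.commute)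

text \<open>The pair leaves level 4. The next three positions are ones and would raise it to 13, one
  above capacity; a fourth one spills entirely.\<close>

lemma overflow_two_zeros:
  assumes "\<not> z (u - 1)" "z u" "z (u + 1)" "\<not> z (u + 2)"
  shows "overflow (u + 4) = 1" "\<not> z (u + 5) \<Longrightarrow> overflow (u + 5) = 3"
  using assms z3[of u] z3[of "u + 1"]
  by (auto simp: overflow_unfold level_def add.commute)

lemma level_periodic:
  assumes "\<And>x. z (x + N) = z x"
  shows "level (u + N) = level u"
proof -
  have "z (u + N - i) = z (u - i)" for i
    using assms[of "u - i"] by (simp add: algebra_simps)
  then show ?thesis
    by (simp add: level_def)
qed

lemma overflow_periodic:
  assumes "\<And>x. z (x + N) = z x"
  shows "overflow (u + N) = overflow u"
  using level_periodic[OF assms, of u] level_periodic[OF assms, of "u + 1"] assms[of u]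
  by (simp add: overflow_def algebra_simps)

text \<open>Over a full period the levels cancel, so the spill equals the total inflow.\<close>

lemma sum_overflow:
  assumes per: "\<And>x. z (x + N) = z x" and "N \<ge> 0"
  shows "(\<Sum>u\<in>{0..<N}. overflow u) = 3 * N - 7 * int (card {u\<in>{0..<N}. z u})"
proof -
  have "(\<Sum>u\<in>{0..<N}. level (u + 1)) = (\<Sum>u\<in>{1..<1 + N}. level u)"
    by (rule sum.reindex_bij_witness[of _ "\<lambda>u. u - 1" "\<lambda>u. u + 1"]) auto
  also have "\<dots> = (\<Sum>u\<in>{0..<N}. level u)"
    using level_periodic[OF per] \<open>N \<ge> 0\<close> by (rule sum_periodic_window)
  finally have "(\<Sum>u\<in>{0..<N}. overflow u) = (\<Sum>u\<in>{0..<N}. 3 - 7 * of_bool (z u))"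
    by (simp add: overflow_def sum.distrib sum_subtractf)
  also have "\<dots> = 3 * N - 7 * (\<Sum>u\<in>{0..<N}. of_bool (z u))"
    using \<open>N \<ge> 0\<close> by (simp add: sum_subtractf sum_distrib_left)
  also have "(\<Sum>u\<in>{0..<N}. of_bool (z u)) = int (card {u\<in>{0..<N}. z u})"
    by (simp add: of_bool_def sum.If_cases Int_def conj_commute)
  finally show ?thesis .
qed

section \<open>Rigidity when less than 3 overflows\<close>

lemma two_zeros_repeat:
  assumes small: "\<And>u. overflow u < 3"
    and u: "\<not> z (u - 1)" "z u" "z (u + 1)" "\<not> z (u + 2)"
  shows "\<not> z (u + 4)" "z (u + 5)" "z (u + 6)" "\<not> z (u + 7)"
proof -
  show n4: "\<not> z (u + 4)"
    using z3[of "u + 1"] u by (simp add: add.commute)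
  show z5: "z (u + 5)"
    using overflow_two_zeros(2)[OF u] small[of "u + 5"] by auto
  \<comment> \<open>The pattern \<open>u + 1\<close>, \<open>u + 5\<close>, \<open>u + 7\<close> is
    forbidden. Without a zero at \<open>u + 6\<close>, the zero at \<open>u + 5\<close> would then
    be isolated and cause a spill of 3.\<close>
  show "\<not> z (u + 7)"
    using z46[of "u + 1"] z5 u by (auto simp: add.commute)
  then show "z (u + 6)"
    using overflow_isolated[of "u + 5"] small[of "u + 8"] z3[of u] n4 z5 u
    by (auto simp: add.commute)
qed

lemma zeros_not_isolated:
  assumes small: "\<And>u. overflow u < 3" and "z u"
  shows "z (u - 1) \<or> z (u + 1)"
proof (rule ccontr)
  assume *: "\<not> (z (u - 1) \<or> z (u + 1))"
  then have "\<not> z (u - 2)" "\<not> z (u + 2)"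
    using overflow_zero_one_zero[of "u - 2"] overflow_zero_one_zero[of u] small[of u] small[of "u + 2"]
      \<open>z u\<close> by auto
  then show False
    using overflow_isolated[of u] small[of "u + 3"] * \<open>z u\<close> by auto
qed

lemma three_zeros_repeat:
  assumes small: "\<And>u. overflow u < 3"
    and u: "z u" "z (u + 1)" "z (u + 2)"
  shows "z (u - 7) \<and> z (u - 6) \<and> z (u - 5)"
proof -
  have no: "\<not> z (u - 1)" "\<not> z (u - 2)" "\<not> z (u - 3)" "\<not> z (u - 4)"
    using z3[of "u - 1"] z3[of "u - 2"] z3[of "u - 3"] z46[of "u - 4"] u by (auto simp: add.commute)
  then have z5: "z (u - 5)"
    using overflow_five_ones[of "u - 1"] small[of "u - 1"] by auto
  then have z6: "z (u - 6)"
    using zeros_not_isolated[OF small z5] no by auto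
  \<comment> \<open>Otherwise \<open>u - 6\<close>, \<open>u - 5\<close> would be a run of length
    two, which forces a zero at \<open>u - 1\<close>.\<close>
  have "z (u - 7)"
    using two_zeros_repeat(2)[OF small, of "u - 6"] z5 z6 no by auto
  with z5 z6 show ?thesis by blast
qed

lemma sum_overflow_ge_3:
  assumes per: "\<And>x. z (x + N) = z x" and N: "N > 10" "\<not> 7 dvd N"
  shows "(\<Sum>u\<in>{0..<N}. overflow u) \<ge> 3"
proof (rule ccontr)
  assume less: "\<not> ?thesis"
  have window: "(\<Sum>u\<in>A. overflow u) < 3" if "A \<subseteq> {a..<a + N}" for A a
  proof -
    have "(\<Sum>u\<in>A. overflow u) \<le> (\<Sum>u\<in>{a..<a + N}. overflow u)"
      using that overflow_nonneg by (intro sum_mono2) auto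
    then show ?thesis
      using less sum_periodic_window[of overflow N a] overflow_periodic[OF per] N by simp
  qed
  have small: "overflow u < 3" for u
    using window[of "{u}" u] N by simp
  have no_two: False if u: "\<not> z (u - 1)" "z u" "z (u + 1)" "\<not> z (u + 2)" for u
  proof -
    have u5: "\<not> z (u + 5 - 1)" "z (u + 5)" "z (u + 5 + 1)" "\<not> z (u + 5 + 2)"
      using two_zeros_repeat[OF small u] by (simp_all add: add.commute)
    have u10: "\<not> z (u + 10 - 1)" "z (u + 10)" "z (u + 10 + 1)" "\<not> z (u + 10 + 2)"
      using two_zeros_repeat[OF small u5] by (simp_all add: add.commute)
    \<comment> \<open>Three successive runs of length two spill 1 each. Their spill positions span
      11 integers, which fit into one period since \<open>N > 10\<close>.\<close>
    have "(\<Sum>v\<in>{u + 4, u + 9, u + 14}. overflow v) = 3"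
      using overflow_two_zeros(1)[OF u] overflow_two_zeros(1)[OF u5] overflow_two_zeros(1)[OF u10]
      by (simp add: add.commute)
    then show False
      using window[of "{u + 4, u + 9, u + 14}" "u + 4"] N by simp
  qed
  define T where "T u \<longleftrightarrow> z u \<and> z (u + 1) \<and> z (u + 2)" for u
  obtain v where "z v"
    using overflow_five_ones[of 0] small[of 0] by auto
  obtain w where w: "z w" "z (w + 1)"
    using zeros_not_isolated[OF small \<open>z v\<close>] \<open>z v\<close> by (metis diff_add_cancel)
  obtain u where u: "T u"
  proof (cases "z (w + 2)")
    case True
    with w show ?thesis using that[of w] by (simp add: T_def)
  next
    case False
    with no_two[of w] w have "z (w - 1)" by blast
    with w show ?thesis using that[of "w - 1"] by (simp add: T_def add.commute)
  qed
  have backward: "T (u - 7 * int j)" for j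
  proof (induction j)
    case (Suc j)
    then show ?case
      using three_zeros_repeat[OF small, of "u - 7 * int j"]
      by (simp add: T_def algebra_simps)
  qed (use u in simp)
  have perm: "z (x + N * m) = z x" for x m
  proof (induction m rule: int_induct[of _ 0])
    case (step1 i)
    then show ?case using per[of "x + N * i"] by (simp add: algebra_simps)
  next
    case (step2 i)
    then show ?case using per[of "x + N * (i - 1)"] by (simp add: algebra_simps)
  qed simp
  \<comment> \<open>As 7 is invertible modulo \<open>N\<close>, steps of -7 from \<open>u\<close>
    reach every residue. Solving \<open>7 * j = -3\<close> reaches \<open>u + 3\<close>, at the
    forbidden distance 3 from the zero \<open>u\<close>.\<close>
  have "coprime 7 N"
    using N(2) by (simp add: prime_imp_coprime)
  then obtain y where y: "[7 * y = - 3] (mod N)"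
    using cong_solve_coprime_int[of 7 N] by (metis cong_scalar_right mult.assoc mult.left_neutral)
  define j where "j = nat (y mod N)"
  have "[7 * int j = - 3] (mod N)"
    using y N(1) by (simp add: j_def cong_def mod_mult_right_eq)
  then obtain m where "u - 7 * int j = u + 3 + N * m"
    by (metis (no_types, opaque_lifting) add_diff_cancel_left' cong_iff_lin diff_add_cancel diff_diff_eq2 diff_minus_eq_add)
  with backward[of j] perm[of "u + 3" m] have "z (u + 3)"
    by (simp add: T_def)
  with z3[of u] u show False
    by (simp add: T_def)
qed

end

section \<open>Words built from a prefix and repeated blocks\<close>

text \<open>Here \<open>a\<close> is meant as the length of the prefix and \<open>Z\<close> as its
  zeros. The blocks \<open>0001111\<close> continue without end; the number of them in use is fixed
  only by the range considered.\<close>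

definition block_zeros :: "int \<Rightarrow> int set \<Rightarrow> int \<Rightarrow> bool" where
  "block_zeros a Z x \<longleftrightarrow> x \<in> Z \<or> a \<le> x \<and> (x - a) mod 7 < 3"

lemma card_block_zeros:
  assumes "Z \<subseteq> {0..<a}" "a \<ge> 0"
  shows "card {x\<in>{0..<a + 7 * int q}. block_zeros a Z x} = card Z + 3 * q"
proof (induction q)
  case 0
  have "{x\<in>{0..<a}. block_zeros a Z x} = Z"
    using assms by (auto simp: block_zeros_def)
  then show ?case by simp
next
  case (Suc q)
  let ?b = "a + 7 * int q"
  have new: "block_zeros a Z x \<longleftrightarrow> x = ?b \<or> x = ?b + 1 \<or> x = ?b + 2" if "?b \<le> x" "x < ?b + 7" for x
  proof -
    have "(x - a) mod 7 = x - ?b"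
      using that by (intro int_mod_pos_eq[of _ _ "int q"]) auto
    moreover have "x \<notin> Z" "a \<le> x"
      using that assms by auto
    ultimately show ?thesis
      using that by (auto simp: block_zeros_def)
  qed
  have "x \<in> {0..<a + 7 * int (Suc q)} \<and> block_zeros a Z x \<longleftrightarrow>
      x \<in> {0..<?b} \<and> block_zeros a Z x \<or> x \<in> {?b, ?b + 1, ?b + 2}" for x
    using new[of x] assms(2) by (cases "?b \<le> x") auto
  then have "{x\<in>{0..<a + 7 * int (Suc q)}. block_zeros a Z x} =
      {x\<in>{0..<?b}. block_zeros a Z x} \<union> {?b, ?b + 1, ?b + 2}"
    by blast
  moreover have "finite {x\<in>{0..<?b}. block_zeros a Z x}"
    by (rule finite_subset[of _ "{0..<?b}"]) auto
  ultimately show ?case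
    using Suc.IH by simp
qed

lemma sparse_zeros_mod_7: "sparse_zeros (\<lambda>x. (x - a) mod 7 < 3)"
proof -
  have t: "(x - a) mod 7 \<in> {0, 1, 2}" if "(x - a) mod 7 < 3" for x
    using that pos_mod_sign[of 7 "x - a"] by force
  have s: "(x + i - a) mod 7 = ((x - a) mod 7 + i) mod 7" for x i
    unfolding mod_add_left_eq by (simp add: algebra_simps)
  show ?thesis
  proof
    fix x
    assume x: "(x - a) mod 7 < 3"
    show "\<not> (x + 3 - a) mod 7 < 3"
      using t[OF x] by (elim insertE emptyE; simp add: s[of x 3])
    show "\<not> (x + 4 - a) mod 7 < 3" if "(x + 2 - a) mod 7 < 3"
      using t[OF x] that by (elim insertE emptyE; simp add: s[of x 2] s[of x 4])
    show "\<not> (x + 6 - a) mod 7 < 3" if "(x + 2 - a) mod 7 < 3"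
      using t[OF x] that by (elim insertE emptyE; simp add: s[of x 2] s[of x 6])
    show "\<not> (x + 6 - a) mod 7 < 3" if "(x + 4 - a) mod 7 < 3"
      using t[OF x] that by (elim insertE emptyE; simp add: s[of x 4] s[of x 6])
  qed
qed

text \<open>Patterns span at most seven positions, so sparsity needs checking only inside the
  periodic part and on the prefix flanked by a block on each side. The zeros -7, -6, -5 are those of
  the last block moved back by \<open>N\<close>.\<close>

lemma sparse_block_zeros:
  assumes Z: "Z \<subseteq> {0..<a}" "a \<ge> 0" and N: "N = a + 7 * q" "q \<ge> 1"
    and sp: "sparse_zeros (\<lambda>x. x \<in> {-7, -6, -5} \<union> Z \<union> {a, a + 1, a + 2})"
  shows "sparse_zeros (\<lambda>x. block_zeros a Z (x mod N))"
proof -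
  interpret S: sparse_zeros "\<lambda>x. x \<in> {-7, -6, -5} \<union> Z \<union> {a, a + 1, a + 2}" by fact
  interpret M: sparse_zeros "\<lambda>x. (x - a) mod 7 < 3" by (rule sparse_zeros_mod_7)
  have near: "block_zeros a Z (y mod N) \<longleftrightarrow> y \<in> {-7, -6, -5} \<union> Z \<union> {a, a + 1, a + 2}"
    if y: "-7 \<le> y" "y < a + 7" for y
  proof (cases "y < 0")
    case True
    then have "y mod N = y + N"
      using N y Z(2) by (intro int_mod_pos_eq[of _ _ "-1"]) auto
    moreover have "(y + N - a) mod 7 = y + 7"
      using N y True by (intro int_mod_pos_eq[of _ _ "q - 1"]) auto
    ultimately show ?thesis
      using N y True Z by (auto simp: block_zeros_def)
  next
    case False
    then have "y mod N = y"
      using N y by (intro mod_pos_pos_trivial) auto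
    moreover have "(y - a) mod 7 = y - a" if "a \<le> y"
      using y that by (intro mod_pos_pos_trivial) auto
    ultimately show ?thesis
      using False Z y by (auto simp: block_zeros_def)
  qed
  have far: "block_zeros a Z (y mod N) \<longleftrightarrow> (y - a) mod 7 < 3" if "a \<le> y" "y < N" for y
    using that Z by (auto simp: block_zeros_def)
  have shift: "block_zeros a Z ((y + i) mod N) \<longleftrightarrow> block_zeros a Z ((x + i) mod N)"
    if "y mod N = x mod N" for x y i
    using that by (metis mod_add_left_eq)
  show ?thesis
  proof (unfold_locales, goal_cases)
    case (1 x)
    \<comment> \<open>With this representative the pattern never wraps around: if
      \<open>y < a\<close> it lies in the flanked prefix, otherwise in the periodic part below
      \<open>N\<close>.\<close>
    obtain y where y: "y mod N = x mod N" "-6 \<le> y" "y < N - 6"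
      by (rule that[of "(x + 6) mod N - 6"]) (use N Z in \<open>auto simp: mod_diff_left_eq algebra_simps\<close>)
    show ?case
      using 1 S.z3[of y] M.z3[of y] near[of y] near[of "y + 3"] far[of y] far[of "y + 3"] y Z
        shift[OF y(1), of 3]
      by (cases "y < a") simp_all
  next
    case (2 x)
    obtain y where y: "y mod N = x mod N" "-6 \<le> y" "y < N - 6"
      by (rule that[of "(x + 6) mod N - 6"]) (use N Z in \<open>auto simp: mod_diff_left_eq algebra_simps\<close>)
    show ?case
      using 2 S.z24[of y] M.z24[of y] near[of y] near[of "y + 2"] near[of "y + 4"]
        far[of y] far[of "y + 2"] far[of "y + 4"] y Z shift[OF y(1), of 2] shift[OF y(1), of 4]
      by (cases "y < a") simp_all
  next
    case (3 x)
    obtain y where y: "y mod N = x mod N" "-6 \<le> y" "y < N - 6"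
      by (rule that[of "(x + 6) mod N - 6"]) (use N Z in \<open>auto simp: mod_diff_left_eq algebra_simps\<close>)
    show ?case
      using 3 S.z26[of y] M.z26[of y] near[of y] near[of "y + 2"] near[of "y + 6"]
        far[of y] far[of "y + 2"] far[of "y + 6"] y Z shift[OF y(1), of 2] shift[OF y(1), of 6]
      by (cases "y < a") simp_all
  next
    case (4 x)
    obtain y where y: "y mod N = x mod N" "-6 \<le> y" "y < N - 6"
      by (rule that[of "(x + 6) mod N - 6"]) (use N Z in \<open>auto simp: mod_diff_left_eq algebra_simps\<close>)
    show ?case
      using 4 S.z46[of y] M.z46[of y] near[of y] near[of "y + 4"] near[of "y + 6"]
        far[of y] far[of "y + 4"] far[of "y + 6"] y Z shift[OF y(1), of 4] shift[OF y(1), of 6]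
      by (cases "y < a") simp_all
  qed
qed

section \<open>Lower and upper bounds\<close>

lemma gamma_SID_circulant_lower:
  assumes n: "n > 11"
  shows "4 * n \<le> 7 * gamma_SID (circulant n {1, 3})"
    and "\<not> 7 dvd n \<Longrightarrow> 4 * n + 3 \<le> 7 * gamma_SID (circulant n {1, 3})"
proof -
  obtain C where C: "self_identifying (circulant n {1, 3}) C"
    "card C = gamma_SID (circulant n {1, 3})"
    using gamma_SID_attained[OF self_identifying_circulant[OF n]] by blast
  have sub: "C \<subseteq> {0..<int n}"
    using C(1) by (simp add: self_identifying_circulant_iff[OF n])
  interpret sparse_zeros "\<lambda>x. x mod int n \<notin> C"
    using n C(1) by (rule self_identifying_imp_sparse_zeros)
  have "{u\<in>{0..<int n}. u mod int n \<notin> C} = {0..<int n} - C"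
    by auto
  then have "int (card {u\<in>{0..<int n}. u mod int n \<notin> C}) = int n - int (card C)"
    using sub card_mono[OF _ sub] by (simp add: card_Diff_subset finite_subset)
  then have sum: "(\<Sum>u\<in>{0..<int n}. overflow u) = 7 * int (card C) - 4 * int n"
    using sum_overflow[of "int n"] by simp
  moreover have "(\<Sum>u\<in>{0..<int n}. overflow u) \<ge> 0"
    by (intro sum_nonneg overflow_nonneg)
  ultimately show "4 * n \<le> 7 * gamma_SID (circulant n {1, 3})"
    using C(2) by simp
  show "4 * n + 3 \<le> 7 * gamma_SID (circulant n {1, 3})" if "\<not> 7 dvd n"
  proof -
    have "\<not> 7 dvd int n"
      using that by presburger
    then show ?thesis
      using sum_overflow_ge_3[of "int n"] sum n C(2) by simp
  qed
qed

text \<open>The code is the complement of the block zeros; \<open>n > 12\<close> avoids the extra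
  condition for 12 vertices. The additive form keeps truncated subtraction out.\<close>

lemma gamma_SID_circulant_block:
  assumes n: "n > 12" "int n = a + 7 * int q" "q \<ge> 1"
    and Z: "Z \<subseteq> {0..<a}" "a \<ge> 0"
    and sp: "sparse_zeros (\<lambda>x. x \<in> {-7, -6, -5} \<union> Z \<union> {a, a + 1, a + 2})"
  shows "gamma_SID (circulant n {1, 3}) + card Z + 3 * q \<le> n"
proof -
  let ?B = "{x\<in>{0..<int n}. block_zeros a Z x}"
  let ?C = "{0..<int n} - ?B"
  have "(\<lambda>x. x mod int n \<notin> ?C) = (\<lambda>x. block_zeros a Z (x mod int n))"
    using n by auto
  then have "sparse_zeros (\<lambda>x. x mod int n \<notin> ?C)"
    using sparse_block_zeros[OF Z n(2) _ sp] n(3) by simp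
  then have "self_identifying (circulant n {1, 3}) ?C"
    using n by (intro sparse_zeros_imp_self_identifying) auto
  then have "gamma_SID (circulant n {1, 3}) \<le> card ?C"
    by (rule gamma_SID_le)
  moreover have "card ?C + card ?B = n"
  proof -
    have sub: "?B \<subseteq> {0..<int n}" by blast
    show ?thesis
      using card_mono[OF _ sub] by (subst card_Diff_subset) (use sub in \<open>auto intro: finite_subset\<close>)
  qed
  moreover have "card ?B = card Z + 3 * q"
    using card_block_zeros[OF Z, of q] n(2) by simp
  ultimately show ?thesis by simp
qed

text \<open>The word is \<open>001111\<close> twice. A block \<open>0001111\<close> has three
  consecutive zeros, which the extra condition for 12 vertices forbids.\<close>

lemma gamma_SID_circulant_12: "gamma_SID (circulant 12 {1, 3}) \<le> 8"
proof -
  let ?C = "{2, 3, 4, 5, 8, 9, 10, 11 :: int}"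
  have t: "x mod 12 \<in> {0, 1, 6, 7}" if "x mod 12 \<notin> ?C" for x :: int
  proof -
    have "y \<in> {0, 1, 6, 7} \<union> ?C" if "0 \<le> y" "y < 12" for y :: int
      unfolding Un_iff insert_iff empty_iff using that by presburger
    from this[of "x mod 12"] that show ?thesis by (simp only: Un_iff) simp
  qed
  have s: "(x + i) mod 12 = (x mod 12 + i) mod 12" for x i :: int
    by (simp add: mod_add_left_eq)
  have "sparse_zeros (\<lambda>x. x mod int 12 \<notin> ?C)"
  proof
    fix x
    assume "x mod int 12 \<notin> ?C"
    then have x: "x mod 12 \<in> {0, 1, 6, 7}"
      using t by simp
    show "\<not> (x + 3) mod int 12 \<notin> ?C"
      using x by (elim insertE emptyE; simp add: s[of x 3])
    show "\<not> (x + 4) mod int 12 \<notin> ?C"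
      using x by (elim insertE emptyE; simp add: s[of x 4])
    show "\<not> (x + 6) mod int 12 \<notin> ?C" if "(x + 2) mod int 12 \<notin> ?C"
      using x that by (elim insertE emptyE; simp add: s[of x 2])
    show "\<not> (x + 6) mod int 12 \<notin> ?C" if "(x + 4) mod int 12 \<notin> ?C"
      using x that by (elim insertE emptyE; simp add: s[of x 4])
  qed
  moreover have "x mod int 12 \<in> ?C \<or> (x + 1) mod int 12 \<in> ?C \<or> (x + 2) mod int 12 \<in> ?C" for x
  proof (cases "x mod 12 \<in> ?C")
    case False
    then have x: "x mod 12 \<in> {0, 1, 6, 7}"
      by (rule t)
    then have "(x + 2) mod 12 \<in> ?C"
      by (elim insertE emptyE; simp add: s[of x 2])
    then show ?thesis by simp
  qed simp
  ultimately have "self_identifying (circulant 12 {1, 3}) ?C"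
    by (intro sparse_zeros_imp_self_identifying) auto
  then have "gamma_SID (circulant 12 {1, 3}) \<le> card ?C"
    by (rule gamma_SID_le)
  then show ?thesis by simp
qed

lemma gamma_SID_circulant_upper:
  assumes "n > 11" and n: "n = 7 * k + r" and "r \<le> 6"
  shows "gamma_SID (circulant n {1, 3}) \<le>
    (if r = 0 then 4 * k
     else if r = 1 then 4 * k + 1
     else if r = 2 then 4 * k + 2
     else if r = 3 \<or> r = 4 then 4 * k + 3
     else 4 * k + 4)"
proof -
  \<comment> \<open>The prefixes for \<open>r = 4\<close> and \<open>r = 5\<close> have length
    \<open>r + 7\<close> and take the place of one block, leaving \<open>k - 1\<close> blocks. In
    the other block cases the prefix has length \<open>r\<close>.\<close>
  consider "r \<le> 3" | "r = 4" | "r = 5" "k = 1" | "r = 5" "k \<ge> 2" | "r = 6"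
    using assms by linarith
  then show ?thesis
  proof cases
    case 1
    then have "k \<ge> 2"
      using assms by presburger
    have sp: "sparse_zeros (\<lambda>x. x \<in> {-7, -6, -5} \<union> {} \<union> {int r, int r + 1, int r + 2})"
      by unfold_locales (use 1 in \<open>auto simp: algebra_simps\<close>)
    have "gamma_SID (circulant n {1, 3}) + card ({} :: int set) + 3 * k \<le> n"
      using assms 1 \<open>k \<ge> 2\<close> by (intro gamma_SID_circulant_block[OF _ _ _ _ _ sp]) auto
    moreover have "r = 0 \<or> r = 1 \<or> r = 2 \<or> r = 3"
      using 1 by linarith
    ultimately show ?thesis
      using n by auto
  next
    case 2
    have sp: "sparse_zeros (\<lambda>x. x \<in> {-7, -6, -5} \<union> {0, 1, 5, 6} \<union> {11, 11 + 1, 11 + 2})"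
      by unfold_locales (elim UnE insertE emptyE; simp)+
    have "gamma_SID (circulant n {1, 3}) + card {0, 1, 5, 6 :: int} + 3 * (k - 1) \<le> n"
      using assms 2 by (intro gamma_SID_circulant_block[OF _ _ _ _ _ sp]) auto
    then show ?thesis
      using assms 2 by simp
  next
    case 3
    then show ?thesis
      using n gamma_SID_circulant_12 by simp
  next
    case 4
    have sp: "sparse_zeros (\<lambda>x. x \<in> {-7, -6, -5} \<union> {0, 1, 6, 7} \<union> {12, 12 + 1, 12 + 2})"
      by unfold_locales (elim UnE insertE emptyE; simp)+
    have "gamma_SID (circulant n {1, 3}) + card {0, 1, 6, 7 :: int} + 3 * (k - 1) \<le> n"
      using assms 4 by (intro gamma_SID_circulant_block[OF _ _ _ _ _ sp]) auto
    then show ?thesis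
      using assms 4 by simp
  next
    case 5
    then have "k \<ge> 1"
      using assms by presburger
    have sp: "sparse_zeros (\<lambda>x. x \<in> {-7, -6, -5} \<union> {0, 1} \<union> {6, 6 + 1, 6 + 2})"
      by unfold_locales (elim UnE insertE emptyE; simp)+
    have "gamma_SID (circulant n {1, 3}) + card {0, 1 :: int} + 3 * k \<le> n"
      using assms 5 \<open>k \<ge> 1\<close> by (intro gamma_SID_circulant_block[OF _ _ _ _ _ sp]) auto
    then show ?thesis
      using assms 5 by simp
  qed
qed

theorem theorem8:
  fixes n k r :: nat
  assumes "n > 11" and "n = 7 * k + r" and "r \<le> 6"
  shows "gamma_SID (circulant n {1, 3}) =
    (if r = 0 then 4 * k
     else if r = 1 then 4 * k + 1
     else if r = 2 then 4 * k + 2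
     else if r = 3 \<or> r = 4 then 4 * k + 3
     else 4 * k + 4)"
proof (rule antisym[OF gamma_SID_circulant_upper[OF assms]])
  let ?g = "gamma_SID (circulant n {1, 3})"
  have "7 dvd n \<longleftrightarrow> r = 0"
    using assms(2,3) by presburger
  then have "4 * (7 * k + r) \<le> 7 * ?g" "r \<noteq> 0 \<Longrightarrow> 4 * (7 * k + r) + 3 \<le> 7 * ?g"
    using gamma_SID_circulant_lower[OF assms(1)] assms(2) by auto
  moreover have "r = 0 \<or> r = 1 \<or> r = 2 \<or> r = 3 \<or> r = 4 \<or> r = 5 \<or> r = 6"
    using assms(3) by linarith
  \<comment> \<open>For \<open>r\<close> from 1 to 6, rounding \<open>(4 * r + 3) / 7\<close> up
    gives 1, 2, 3, 3, 4, 4.\<close>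
  ultimately show "(if r = 0 then 4 * k
     else if r = 1 then 4 * k + 1
     else if r = 2 then 4 * k + 2
     else if r = 3 \<or> r = 4 then 4 * k + 3
     else 4 * k + 4) \<le> ?g"
    by (elim disjE) simp_all
qed

end
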